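(* Let $i\ge1$ and consider a complete phase of $\mathrm{ALG}_i$. Let $\mathrm{ADV}_i$ be any offline adversary using servers $s_1,\dots,s_i$ (in $M_1,\dots,M_i$) that may choose any initial configuration and may ignore (not serve) any set of at most a $4/c(i+1)$ fraction of the requests of the phase, serving all others. Then $\mathrm{cost}(\mathrm{ALG}_i)\le R_i\cdot\mathrm{cost}(\mathrm{ADV}_i)$, where both costs are the movement costs incurred during the phase.
   Context: Generalized $k$-server on weighted uniform metrics: server $s_i$ lives in a uniform metric $M_i$ with all pairwise distances $w_i$; a request is $r=(r(1),\dots,r(k))$ with $r(i)\in M_i$ and is served if some $s_i$ is at $r(i)$; moving $s_i$ costs $w_i$. Set $c(i)=2^{2^{i+1}-3}$ and $R_i=2^{2^{i+2}}$ for all $i\ge1$. Standing assumptions: $w_1=1$; for $2\le i\le k$, $w_i$ is an integer multiple of $2(1+c(i-1))w_{i-1}$; $|M_i|\ge c(i)$; and every request presented to $\mathrm{ALG}_i$ is not satisfied by the current positions of its servers $s_1,\dots,s_i$ (so it must move a server at every request). Algorithms $\mathrm{ALG}_i$ (using $s_1,\dots,s_i$) work in phases. $\mathrm{ALG}_1$: on each request move $s_1$ to the requested point; a phase consists of $6$ requests and is complete once 6 requests are served. $\mathrm{ALG}_i$, $i\ge2$: a phase consists of $c(i)+1$ subphases. First move $s_i$ to an arbitrary point of $M_i$ and run $\mathrm{ALG}_{i-1}$ (started afresh) on incoming requests until the cost incurred by $\mathrm{ALG}_{i-1}$ equals exactly $w_i$ (learning subphase). For $p\in M_i$ let $m(p)$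 be the number of learning-subphase requests with $r(i)=p$, and let $P$ be a set of $c(i)$ points with largest counts (ties broken arbitrarily). Then $c(i)$ times: move $s_i$ to a point of $P$ not yet visited in this phase and run $\mathrm{ALG}_{i-1}$ until its cost in this subphase equals $w_i$. A phase of $\mathrm{ALG}_i$, $i\ge2$, is complete if all its subphases are finished. *)

theory Defs
  imports Complex_Main "HOL-Library.Sublist"
begin

definition cpar :: "nat \<Rightarrow> nat" where
  "cpar i = 2 ^ (2 ^ (i + 1) - 3)"

definition Rpar :: "nat \<Rightarrow> nat" where
  "Rpar i = 2 ^ (2 ^ (i + 2))"

text \<open>The uniform metric spaces are carriers \<open>M 1, \<dots>, M k\<close> inside one ambient type of points.
  Servers, coordinates of requests and weights are indexed from 1; index 0 is never used.\<close>

type_synonym 'p config = "nat \<Rightarrow> 'p"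
type_synonym 'p request = "nat \<Rightarrow> 'p"

definition udist :: "real \<Rightarrow> 'p \<Rightarrow> 'p \<Rightarrow> real" where
  "udist x p q = (if p = q then 0 else x)"

definition config_in :: "(nat \<Rightarrow> 'p set) \<Rightarrow> nat \<Rightarrow> 'p config \<Rightarrow> bool" where
  "config_in M i C \<longleftrightarrow> (\<forall>j\<in>{1..i}. C j \<in> M j)"

definition serves :: "nat \<Rightarrow> 'p config \<Rightarrow> 'p request \<Rightarrow> bool" where
  "serves i C r \<longleftrightarrow> (\<exists>j\<in>{1..i}. C j = r j)"

text \<open>The behaviour of an online algorithm is recorded as the chronological list of the requests
  it receives and of the server movements it makes. A \<open>Move\<close> to the current position of the
  server is possible and costs nothing.\<close>

datatype 'p event = Request "'p request" | Move nat 'p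

type_synonym 'p trace = "'p event list"

fun after :: "'p config \<Rightarrow> 'p trace \<Rightarrow> 'p config" where
  "after C [] = C"
| "after C (Request r # t) = after C t"
| "after C (Move j p # t) = after (C(j := p)) t"

fun trace_cost :: "(nat \<Rightarrow> real) \<Rightarrow> 'p config \<Rightarrow> 'p trace \<Rightarrow> real" where
  "trace_cost w C [] = 0"
| "trace_cost w C (Request r # t) = trace_cost w C t"
| "trace_cost w C (Move j p # t) = udist (w j) (C j) p + trace_cost w (C(j := p)) t"

fun requests :: "'p trace \<Rightarrow> 'p request list" where
  "requests [] = []"
| "requests (Request r # t) = r # requests t"
| "requests (Move j p # t) = requests t"

text \<open>Every request is a tuple of points of the spaces and, at the moment it is presented, is not
  satisfied by the current positions of the servers \<open>1, \<dots>, i\<close>.\<close>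

fun admissible :: "(nat \<Rightarrow> 'p set) \<Rightarrow> nat \<Rightarrow> 'p config \<Rightarrow> 'p trace \<Rightarrow> bool" where
  "admissible M i C [] \<longleftrightarrow> True"
| "admissible M i C (Request r # t) \<longleftrightarrow>
     (\<forall>j\<in>{1..i}. r j \<in> M j) \<and> \<not> serves i C r \<and> admissible M i C t"
| "admissible M i C (Move j p # t) \<longleftrightarrow> admissible M i (C(j := p)) t"

text \<open>In the following, \<open>ph C t\<close> says that an algorithm started afresh in configuration \<open>C\<close> may
  perform \<open>t\<close> as one complete phase.\<close>

fun phase_seq :: "('p config \<Rightarrow> 'p trace \<Rightarrow> bool) \<Rightarrow> 'p config \<Rightarrow> 'p trace list \<Rightarrow> bool" where
  "phase_seq ph C [] \<longleftrightarrow> True"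
| "phase_seq ph C (t # ts) \<longleftrightarrow> ph C t \<and> phase_seq ph (after C t) ts"

text \<open>The algorithm is run from \<open>C\<close>, phase after phase, and stopped at the first moment at which
  its cost equals \<open>x\<close>. The last phase may be cut off by this.\<close>

definition run_until ::
    "(nat \<Rightarrow> real) \<Rightarrow> ('p config \<Rightarrow> 'p trace \<Rightarrow> bool) \<Rightarrow> real \<Rightarrow> 'p config \<Rightarrow> 'p trace \<Rightarrow> bool" where
  "run_until w ph x C t \<longleftrightarrow>
     (\<exists>ts. phase_seq ph C ts \<and> prefix t (concat ts)) \<and>
     trace_cost w C t = x \<and>
     (\<forall>t'. strict_prefix t' t \<longrightarrow> trace_cost w C t' < x)"

text \<open>Server \<open>i\<close> visits the given points in order; after each of these moves a subphase
  described by \<open>run\<close> takes place.\<close>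

fun visits :: "nat \<Rightarrow> ('p config \<Rightarrow> 'p trace \<Rightarrow> bool) \<Rightarrow> 'p list \<Rightarrow> 'p config \<Rightarrow> 'p trace \<Rightarrow> bool" where
  "visits i run [] C t \<longleftrightarrow> t = []"
| "visits i run (p # ps) C t \<longleftrightarrow>
     (\<exists>u v. t = Move i p # u @ v \<and> run (C(i := p)) u \<and> visits i run ps (after (C(i := p)) u) v)"

definition req_count :: "nat \<Rightarrow> 'p trace \<Rightarrow> 'p \<Rightarrow> nat" where
  "req_count i t p = length (filter (\<lambda>r. r i = p) (requests t))"

definition top_points :: "nat \<Rightarrow> 'p set \<Rightarrow> ('p \<Rightarrow> nat) \<Rightarrow> 'p set \<Rightarrow> bool" where
  "top_points n X m P \<longleftrightarrow>
     P \<subseteq> X \<and> finite P \<and> card P = n \<and> (\<forall>p\<in>P. \<forall>q\<in>X - P. m q \<le> m p)"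

text \<open>\<open>alg_phase M w i C t\<close>: starting in configuration \<open>C\<close>, the list \<open>t\<close> is a complete phase of
  the \<open>i\<close>-th algorithm. All arbitrary choices (the point \<open>a\<close> of the learning subphase, the ties
  in the choice of \<open>P\<close>, the order \<open>ps\<close> in which \<open>P\<close> is visited) are existentially quantified, so
  that a statement about all such \<open>t\<close> covers every way of making them. The point \<open>a\<close> can belong
  to \<open>P\<close> (it has to if \<open>M i\<close> has only \<open>cpar i\<close> points), and is then visited again.\<close>

fun alg_phase ::
    "(nat \<Rightarrow> 'p set) \<Rightarrow> (nat \<Rightarrow> real) \<Rightarrow> nat \<Rightarrow> 'p config \<Rightarrow> 'p trace \<Rightarrow> bool" where
  "alg_phase M w 0 C t \<longleftrightarrow> False"
| "alg_phase M w (Suc 0) C t \<longleftrightarrow>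
     (\<exists>rs. length rs = 6 \<and> t = concat (map (\<lambda>r. [Request r, Move 1 (r 1)]) rs))"
| "alg_phase M w (Suc (Suc n)) C t \<longleftrightarrow>
     (let i = Suc (Suc n); run = run_until w (\<lambda>C t. alg_phase M w (Suc n) C t) (w i) in
      \<exists>a u P ps v.
        a \<in> M i \<and> run (C(i := a)) u \<and>
        top_points (cpar i) (M i) (req_count i u) P \<and>
        distinct ps \<and> set ps = P \<and> visits i run ps (after (C(i := a)) u) v \<and>
        t = Move i a # u @ v)"

text \<open>An offline adversary on the requests \<open>rs\<close> chooses an initial configuration \<open>A 0\<close> and for each
  \<open>t < length rs\<close> the configuration \<open>A (Suc t)\<close> in which it faces the request \<open>rs ! t\<close>; the
  requests with index in \<open>I\<close> are ignored.\<close>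

definition adversary ::
    "(nat \<Rightarrow> 'p set) \<Rightarrow> nat \<Rightarrow> 'p request list \<Rightarrow> nat set \<Rightarrow> (nat \<Rightarrow> 'p config) \<Rightarrow> bool" where
  "adversary M i rs I A \<longleftrightarrow>
     (\<forall>t\<le>length rs. config_in M i (A t)) \<and>
     (\<forall>t<length rs. t \<notin> I \<longrightarrow> serves i (A (Suc t)) (rs ! t))"

definition adv_cost :: "(nat \<Rightarrow> real) \<Rightarrow> nat \<Rightarrow> nat \<Rightarrow> (nat \<Rightarrow> 'p config) \<Rightarrow> real" where
  "adv_cost w i n A = (\<Sum>t<n. \<Sum>j=1..i. udist (w j) (A t j) (A (Suc t) j))"

end

theory Submission
  imports Defs
begin

text \<open>By induction on \<open>i\<close>, every adversary that ignores few requests of a complete phase pays at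
  least \<open>2 (1 + c(i)) w\<^sub>i / R\<^sub>i\<close>, where \<open>2 (1 + c(i)) w\<^sub>i\<close> bounds the cost of the algorithm.
  This is clear if the adversary moves server \<open>i\<close>. Otherwise this server stays at a point \<open>p\<close>.
  If \<open>p\<close> lies in \<open>P\<close>, it is useless during the subphase in which the algorithm parks there;
  if not, it serves at most a fraction \<open>1 / (1 + c(i))\<close> of the learning subphase, by the choice of
  \<open>P\<close>. So there is a subphase in which the servers below \<open>i\<close> serve all but about a fraction
  \<open>2 / c(i)\<close> of the requests. At least half of the complete phases of the \<open>(i - 1)\<close>-st algorithm
  in it then meet the bound \<open>4 / c(i)\<close> of the induction hypothesis.

  Fractions of requests have to be compared between different subphases, so one also needs that
  all subphases have about the same number of requests. This is not automatic, since a server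
  may already be at the point it should move to, and then phases are cheaper and a
  subphase can end inside a phase. The resulting errors are of relative order \<open>1 / c(j)\<close> on level
  \<open>j\<close>, and \<open>c\<close> grows so fast that they add up to at most a quarter.\<close>

subsection \<open>Traces\<close>

lemma after_append: "after C (t @ u) = after (after C t) u"
  by (induction t arbitrary: C rule: requests.induct) auto

lemma trace_cost_append:
  "trace_cost w C (t @ u) = trace_cost w C t + trace_cost w (after C t) u"
  by (induction t arbitrary: C rule: requests.induct) auto

lemma requests_append: "requests (t @ u) = requests t @ requests u"
  by (induction t rule: requests.induct) auto

lemma admissible_append:
  "admissible M i C (t @ u) \<longleftrightarrow> admissible M i C t \<and> admissible M i (after C t) u"
  by (induction t arbitrary: C rule: requests.induct) auto

lemmas trace_append = after_append trace_cost_append requests_append admissible_append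

lemma serves_mono: "serves i C r \<Longrightarrow> i \<le> j \<Longrightarrow> serves j C r"
  unfolding serves_def by fastforce

lemma admissible_antimono: "admissible M j C t \<Longrightarrow> i \<le> j \<Longrightarrow> admissible M i C t"
  by (induction t arbitrary: C rule: requests.induct) (auto dest: serves_mono)

lemma udist_nonneg: "0 \<le> x \<Longrightarrow> 0 \<le> udist x p q"
  and udist_le: "0 \<le> x \<Longrightarrow> udist x p q \<le> x"
  by (auto simp: udist_def)

lemma prefix_append_cases:
  assumes "prefix s (x @ y)"
  obtains "prefix s x" | z where "s = x @ z" "prefix z y" "z \<noteq> []"
  using assms by (cases "prefix s x") (auto simp: prefix_append)

lemma strict_prefix_append_cases:
  assumes "strict_prefix s (x @ y)"
  obtains "strict_prefix s x" | z where "s = x @ z" "strict_prefix z y"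
  using assms by (cases "s = x") (auto simp: strict_prefix_def prefix_append)

text \<open>A run on level \<open>i\<close> never touches server \<open>i + 1\<close>, so that
  server stays parked for a whole subphase.\<close>

definition moves_within :: "nat \<Rightarrow> 'p trace \<Rightarrow> bool" where
  "moves_within i t \<longleftrightarrow> (\<forall>j p. Move j p \<in> set t \<longrightarrow> j \<le> i)"

lemma moves_within_simps [simp]:
  "moves_within i []"
  "moves_within i (Request r # t) \<longleftrightarrow> moves_within i t"
  "moves_within i (Move j p # t) \<longleftrightarrow> j \<le> i \<and> moves_within i t"
  "moves_within i (t @ u) \<longleftrightarrow> moves_within i t \<and> moves_within i u"
  by (auto simp: moves_within_def)

lemma moves_within_run_until:
  assumes "\<And>C t. ph C t \<Longrightarrow> moves_within i t" "run_until w ph x C t"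
  shows "moves_within i t"
proof -
  have "moves_within i (concat ts)" if "phase_seq ph C ts" for C ts
    using that by (induction ts arbitrary: C) (auto simp: assms(1))
  then show ?thesis
    using assms(2) set_mono_prefix unfolding run_until_def moves_within_def by blast
qed

lemma moves_within_visits:
  assumes "\<And>C t. run C t \<Longrightarrow> moves_within i t" "visits i run ps C t"
  shows "moves_within i t"
  using assms(2)
proof (induction ps arbitrary: C t)
  case (Cons p ps)
  then obtain u v where "t = Move i p # u @ v" "run (C(i := p)) u"
    "visits i run ps (after (C(i := p)) u) v" by auto
  then show ?case using Cons.IH assms(1) by auto
qed auto

lemma moves_within_mono: "moves_within i t \<Longrightarrow> i \<le> j \<Longrightarrow> moves_within j t"
  by (fastforce simp: moves_within_def)

lemma after_moves_within: "moves_within i t \<Longrightarrow> i < j \<Longrightarrow> after C t j = C j"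
  by (induction t arbitrary: C rule: requests.induct) auto

text \<open>Server \<open>i\<close> stays at \<open>C i\<close> throughout, and an admissible
  request is never satisfied on arrival. An adversary whose server \<open>i\<close> sits at the same
  point therefore cannot use it here.\<close>

lemma request_avoids_parked_server:
  assumes "admissible M i C t" "moves_within j t" "j < i" "r \<in> set (requests t)"
  shows "r i \<noteq> C i"
  using assms
proof (induction t arbitrary: C rule: requests.induct)
  case (2 r' t)
  moreover have "i \<in> {1..i}" using \<open>j < i\<close> by simp
  ultimately have "r' i \<noteq> C i" unfolding admissible.simps serves_def by metis
  then show ?case using 2 by auto
next
  case (3 l p t)
  then have "l \<noteq> i" by auto
  moreover have "r i \<noteq> (C(l := p)) i" 
    by (rule "3.IH") (use "3.prems" in \<open>auto simp del: fun_upd_apply\<close>)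
  ultimately show ?case by simp
qed auto

lemma request_in_space:
  "admissible M i C t \<Longrightarrow> r \<in> set (requests t) \<Longrightarrow> j \<in> {1..i} \<Longrightarrow> r j \<in> M j"
  by (induction t arbitrary: C rule: requests.induct) auto

subsection \<open>Runs and visits\<close>

lemma phase_seq_snoc:
  "phase_seq ph C (ts @ [t]) \<longleftrightarrow> phase_seq ph C ts \<and> ph (after C (concat ts)) t"
  by (induction ts arbitrary: C) (auto simp: after_append)

text \<open>The last piece \<open>s\<close> is non-empty and may be a whole phase. It is not
  absorbed into \<open>ts'\<close>, because upper bounds on the number of requests look at the cost
  strictly before the end of \<open>t\<close>.\<close>

lemma prefix_phase_seq:
  assumes "phase_seq ph C ts" "prefix t (concat ts)" "t \<noteq> []"
  obtains ts' s u where "t = concat ts' @ s" "phase_seq ph C ts'"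
    "ph (after C (concat ts')) u" "prefix s u" "s \<noteq> []"
proof -
  have "\<exists>ts' s u. t = concat ts' @ s \<and> phase_seq ph C ts' \<and>
      ph (after C (concat ts')) u \<and> prefix s u \<and> s \<noteq> []"
    using assms
  proof (induction ts arbitrary: C t)
    case (Cons x ts)
    have "prefix t (x @ concat ts)" using Cons.prems by simp
    then show ?case
    proof (cases rule: prefix_append_cases)
      case 1
      then show ?thesis using Cons.prems by (intro exI[of _ "[]"] exI[of _ t] exI[of _ x]) auto
    next
      case (2 z)
      then obtain ts' s u where "z = concat ts' @ s" "phase_seq ph (after C x) ts'"
        "ph (after (after C x) (concat ts')) u" "prefix s u" "s \<noteq> []"
        using Cons.IH[of "after C x" z] Cons.prems by auto
      then show ?thesis using Cons.prems 2
        by (intro exI[of _ "x # ts'"] exI[of _ s] exI[of _ u]) (auto simp: after_append)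
    qed
  qed auto
  then show thesis using that by blast
qed

text \<open>Here a last piece that is a whole phase is moved into \<open>ts\<close>. What remains is
  a proper prefix of a phase, as needed for counting complete phases from below.\<close>

lemma run_until_split:
  assumes "run_until w ph x C t"
  obtains ts s where "t = concat ts @ s" "phase_seq ph C ts"
    "s = [] \<or> (\<exists>u. ph (after C (concat ts)) u \<and> strict_prefix s u)"
proof (cases "t = []")
  case True
  then show thesis using that[of "[]" "[]"] by auto
next
  case False
  obtain us where us: "phase_seq ph C us" "prefix t (concat us)"
    using assms by (auto simp: run_until_def)
  obtain ts s u where *: "t = concat ts @ s" "phase_seq ph C ts"
    "ph (after C (concat ts)) u" "prefix s u" "s \<noteq> []"
    using prefix_phase_seq[OF us False] by blast
  show thesis
  proof (cases "s = u")
    case True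
    then show thesis using that[of "ts @ [u]" "[]"] * by (auto simp: phase_seq_snoc)
  next
    case False
    then show thesis using that[of ts s] * by (auto simp: strict_prefix_def)
  qed
qed

section \<open>Costs and request numbers of a sequence of visits\<close>

lemma visits_cost_le:
  assumes "\<And>C t. run C t \<Longrightarrow> trace_cost w C t = w i" "0 < w i" "visits i run ps C t"
  shows "trace_cost w C t \<le> 2 * real (length ps) * w i"
  using assms(3)
proof (induction ps arbitrary: C t)
  case (Cons p ps)
  then obtain u v where *: "t = Move i p # u @ v" "run (C(i := p)) u"
    "visits i run ps (after (C(i := p)) u) v" by auto
  then show ?case
    using Cons.IH[OF *(3)] assms(1)[OF *(2)] udist_le[of "w i" "C i" p] assms(2)
    by (auto simp: trace_append algebra_simps)
qed auto

text \<open>A run ends the first time its cost reaches \<open>w i\<close>, so a cut before or inside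
  the last run stays strictly below the full bound.\<close>

lemma visits_strict_prefix_cost_less:
  assumes "\<And>C t. run C t \<Longrightarrow> trace_cost w C t = w i"
    and "\<And>C t s. run C t \<Longrightarrow> strict_prefix s t \<Longrightarrow> trace_cost w C s < w i"
    and "0 < w i" "visits i run ps C t" "strict_prefix s t"
  shows "trace_cost w C s < 2 * real (length ps) * w i"
  using assms(4,5)
proof (induction ps arbitrary: C t s)
  case (Cons p ps)
  then obtain u v where *: "t = Move i p # u @ v" "run (C(i := p)) u"
    "visits i run ps (after (C(i := p)) u) v" by auto
  have move: "udist (w i) (C i) p \<le> w i" using assms(3) by (simp add: udist_le)
  have nn: "0 \<le> real (length ps) * w i" using assms(3) by simp
  show ?case
  proof (cases s)
    case Nil
    then show ?thesis using assms(3) by simp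
  next
    case (Cons e s')
    then have e: "e = Move i p" and "strict_prefix s' (u @ v)"
      using Cons.prems(2) * by auto
    from this(2) show ?thesis
    proof (cases rule: strict_prefix_append_cases)
      case 1
      then show ?thesis using assms(2)[OF *(2) 1] move nn Cons e
        by (auto simp: algebra_simps)
    next
      case (2 z)
      then show ?thesis using Cons.IH[OF *(3) 2(2)] assms(1)[OF *(2)] move Cons e
        by (auto simp: trace_append algebra_simps)
    qed
  qed
qed auto

text \<open>Server \<open>i\<close> is still at \<open>p\<close> after the run that follows its move
  to \<open>p\<close>, so with distinct points and a start outside \<open>ps\<close> no move is
  free.\<close>

lemma visits_cost_eq:
  assumes "\<And>C t. run C t \<Longrightarrow> trace_cost w C t = w i"
    and "\<And>C t. run C t \<Longrightarrow> after C t i = C i"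
    and "visits i run ps C t" "distinct ps" "C i \<notin> set ps"
  shows "trace_cost w C t = 2 * real (length ps) * w i"
  using assms(3-)
proof (induction ps arbitrary: C t)
  case (Cons p ps)
  then obtain u v where *: "t = Move i p # u @ v" "run (C(i := p)) u"
    "visits i run ps (after (C(i := p)) u) v" by auto
  have "after (C(i := p)) u i = p" using assms(2)[OF *(2)] by simp
  then show ?case
    using Cons.IH[OF *(3)] Cons.prems assms(1)[OF *(2)] *(1)
    by (auto simp: trace_append algebra_simps udist_def)
qed auto

text \<open>Only the first move can be free, namely if server \<open>i\<close> already stands on the
  first point; this accounts for the \<open>- 1\<close>.\<close>

lemma visits_cost_ge:
  assumes "\<And>C t. run C t \<Longrightarrow> trace_cost w C t = w i"
    and "\<And>C t. run C t \<Longrightarrow> after C t i = C i"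
    and "0 < w i" "visits i run ps C t" "distinct ps"
  shows "(2 * real (length ps) - 1) * w i \<le> trace_cost w C t"
proof (cases ps)
  case (Cons p qs)
  then obtain u v where *: "t = Move i p # u @ v" "run (C(i := p)) u"
    "visits i run qs (after (C(i := p)) u) v" using assms(4) by auto
  have "after (C(i := p)) u i = p" using assms(2)[OF *(2)] by simp
  then have "trace_cost w (after (C(i := p)) u) v = 2 * real (length qs) * w i"
    using visits_cost_eq[OF assms(1,2) *(3)] assms(5) Cons by auto
  then show ?thesis
    using assms(1)[OF *(2)] * Cons udist_nonneg[of "w i" "C i" p] assms(3)
    by (auto simp: trace_append algebra_simps)
qed (use assms in auto)

lemma visits_length_ge:
  assumes "\<And>C t. run C t \<Longrightarrow> admissible M i C t \<Longrightarrow> a \<le> real (length (requests t))"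
    and "visits i run ps C t" "admissible M i C t"
  shows "real (length ps) * a \<le> real (length (requests t))"
  using assms(2,3)
proof (induction ps arbitrary: C t)
  case (Cons p ps)
  then obtain u v where *: "t = Move i p # u @ v" "run (C(i := p)) u"
    "visits i run ps (after (C(i := p)) u) v" by auto
  then show ?case
    using Cons.IH[OF *(3)] Cons.prems assms(1)[OF *(2)]
    by (auto simp: trace_append algebra_simps)
qed auto

lemma visits_length_le:
  assumes "\<And>C t. run C t \<Longrightarrow> admissible M i C t \<Longrightarrow> real (length (requests t)) \<le> b"
    and "visits i run ps C t" "admissible M i C t"
  shows "real (length (requests t)) \<le> real (length ps) * b"
  using assms(2,3)
proof (induction ps arbitrary: C t)
  case (Cons p ps)
  then obtain u v where *: "t = Move i p # u @ v" "run (C(i := p)) u"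
    "visits i run ps (after (C(i := p)) u) v" by auto
  then show ?case
    using Cons.IH[OF *(3)] Cons.prems assms(1)[OF *(2)]
    by (auto simp: trace_append algebra_simps)
qed auto

lemma visits_member:
  assumes "visits i run ps C t" "p \<in> set ps"
  obtains t1 u t2 where "t = t1 @ Move i p # u @ t2" "run ((after C t1)(i := p)) u"
proof -
  have "\<exists>t1 u t2. t = t1 @ Move i p # u @ t2 \<and> run ((after C t1)(i := p)) u"
    using assms
  proof (induction ps arbitrary: C t)
    case (Cons q ps)
    then obtain u v where *: "t = Move i q # u @ v" "run (C(i := q)) u"
      "visits i run ps (after (C(i := q)) u) v" by auto
    show ?case
    proof (cases "p = q")
      case True
      then have "t = [] @ Move i p # u @ v \<and> run ((after C [])(i := p)) u" using * by simp
      then show ?thesis by blast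
    next
      case False
      then have "p \<in> set ps" using Cons.prems by simp
      then obtain t1 u' t2 where "v = t1 @ Move i p # u' @ t2"
        "run ((after (after (C(i := q)) u) t1)(i := p)) u'"
        using Cons.IH[OF *(3)] by blast
      then have "t = (Move i q # u @ t1) @ Move i p # u' @ t2 \<and>
          run ((after C (Move i q # u @ t1))(i := p)) u'"
        using * by (simp add: after_append)
      then show ?thesis by blast
    qed
  qed auto
  then show thesis using that by blast
qed

text \<open>\<open>j\<close> is the number of subphases completed before the one in which
  \<open>s\<close> ends, and \<open>s'\<close> a moment by which they are paid for. Strictness of
  \<open>s'\<close> matters: the stopping rule bounds the cost only before the end of
  \<open>s\<close>.\<close>

lemma visits_prefix_length:
  assumes "\<And>C t. run C t \<Longrightarrow> trace_cost w C t = w i" "0 < w i"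
    and "\<And>C t s. run C t \<Longrightarrow> prefix s t \<Longrightarrow> admissible M i C s \<Longrightarrow>
        real (length (requests s)) \<le> b"
    and "visits i run ps C t" "prefix s t" "s \<noteq> []" "admissible M i C s"
  obtains j s' where "j < length ps" "strict_prefix s' s" "real j * w i \<le> trace_cost w C s'"
    "real (length (requests s)) \<le> real (j + 1) * b"
proof -
  have "\<exists>j s'. j < length ps \<and> strict_prefix s' s \<and> real j * w i \<le> trace_cost w C s' \<and>
      real (length (requests s)) \<le> real (j + 1) * b"
    using assms(4-)
  proof (induction ps arbitrary: C t s)
    case (Cons p ps)
    then obtain u v where *: "t = Move i p # u @ v" "run (C(i := p)) u"
      "visits i run ps (after (C(i := p)) u) v" by auto
    obtain s1 where s1: "s = Move i p # s1" "prefix s1 (u @ v)"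
      using Cons.prems * by (cases s) auto
    from s1(2) show ?case
    proof (cases rule: prefix_append_cases)
      case 1
      then show ?thesis using assms(3)[OF *(2) 1] Cons.prems s1
        by (intro exI[of _ 0] exI[of _ "[]"]) auto
    next
      case (2 z)
      have "admissible M i (after (C(i := p)) u) z" "admissible M i (C(i := p)) u"
        using Cons.prems s1 2 by (auto simp: trace_append)
      moreover obtain j s' where "j < length ps" "strict_prefix s' z"
        "real j * w i \<le> trace_cost w (after (C(i := p)) u) s'"
        "real (length (requests z)) \<le> real (j + 1) * b"
        using Cons.IH[OF *(3) 2(2,3) calculation(1)] by blast
      moreover from this have "strict_prefix (u @ s') (u @ z)" by (auto simp: strict_prefix_def)
      ultimately show ?thesis
        using assms(1)[OF *(2)] assms(3)[OF *(2) prefix_order.refl] s1 2 *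
          udist_nonneg[of "w i" "C i" p] assms(2)
        by (intro exI[of _ "Suc j"] exI[of _ "Move i p # u @ s'"])
          (auto simp: trace_append algebra_simps)
    qed
  qed auto
  then show thesis using that by blast
qed

text \<open>Unlike \<open>run_until\<close>, this is inherited by prefixes.\<close>

definition cut_run ::
    "(nat \<Rightarrow> real) \<Rightarrow> ('p config \<Rightarrow> 'p trace \<Rightarrow> bool) \<Rightarrow> real \<Rightarrow> 'p config \<Rightarrow> 'p trace \<Rightarrow> bool" where
  "cut_run w ph x C t \<longleftrightarrow>
     (\<exists>ts. phase_seq ph C ts \<and> prefix t (concat ts)) \<and>
     (\<forall>t'. strict_prefix t' t \<longrightarrow> trace_cost w C t' < x)"

lemma cut_run_prefix: "run_until w ph x C t \<Longrightarrow> prefix s t \<Longrightarrow> cut_run w ph x C s"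
  unfolding run_until_def cut_run_def
  by (meson prefix_order.less_le_trans prefix_order.order_trans)

subsection \<open>Offline adversaries\<close>

text \<open>Replaces the set of ignored requests by a number, so that one adversary \<open>A\<close>
  can be judged on every level and on every infix of the requests.\<close>

definition unserved :: "nat \<Rightarrow> (nat \<Rightarrow> 'p config) \<Rightarrow> 'p request list \<Rightarrow> nat" where
  "unserved i A rs = card {t. t < length rs \<and> \<not> serves i (A (Suc t)) (rs ! t)}"

text \<open>The shifted adversary starts in the configuration reached after \<open>xs\<close>; this
  is legitimate because initial configurations are free.\<close>

lemma unserved_append:
  "unserved i A (xs @ ys) = unserved i A xs + unserved i (\<lambda>t. A (t + length xs)) ys"
proof -
  let ?X = "{t. t < length xs \<and> \<not> serves i (A (Suc t)) (xs ! t)}"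
  let ?Y = "{t. t < length ys \<and> \<not> serves i (A (Suc t + length xs)) (ys ! t)}"
  have "{t. t < length (xs @ ys) \<and> \<not> serves i (A (Suc t)) ((xs @ ys) ! t)} =
      ?X \<union> (\<lambda>t. t + length xs) ` ?Y" (is "?Z = _")
  proof (intro set_eqI iffI)
    fix t assume t: "t \<in> ?Z"
    show "t \<in> ?X \<union> (\<lambda>t. t + length xs) ` ?Y"
    proof (cases "t < length xs")
      case True
      then show ?thesis using t by (auto simp: nth_append)
    next
      case False
      then have "t = (t - length xs) + length xs" "t - length xs \<in> ?Y"
        using t by (auto simp: nth_append)
      then show ?thesis by blast
    qed
  qed (auto simp: nth_append)
  moreover have "card (?X \<union> (\<lambda>t. t + length xs) ` ?Y) = card ?X + card ((\<lambda>t. t + length xs) ` ?Y)"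
    by (rule card_Un_disjoint) auto
  ultimately show ?thesis by (simp add: unserved_def card_image)
qed

lemma adv_cost_add:
  "adv_cost w i (m + n) A = adv_cost w i m A + adv_cost w i n (\<lambda>t. A (t + m))"
  unfolding adv_cost_def by (induction n) (auto simp: add.commute)

lemma adv_cost_nonneg: "(\<And>j. j \<in> {1..i} \<Longrightarrow> 0 \<le> w j) \<Longrightarrow> 0 \<le> adv_cost w i n A"
  unfolding adv_cost_def by (intro sum_nonneg) (auto intro: udist_nonneg)

lemma adv_cost_mono:
  assumes "\<And>j. j \<in> {1..i'} \<Longrightarrow> 0 \<le> w j" "i \<le> i'"
  shows "adv_cost w i n A \<le> adv_cost w i' n A"
  unfolding adv_cost_def
  by (intro sum_mono sum_mono2) (use assms in \<open>auto intro: udist_nonneg\<close>)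

lemma adv_cost_infix:
  assumes "\<And>j. j \<in> {1..i} \<Longrightarrow> 0 \<le> w j"
  shows "adv_cost w i (length ys) (\<lambda>t. A (t + length xs)) \<le> adv_cost w i (length (xs @ ys @ zs)) A"
proof -
  have nn: "0 \<le> adv_cost w i n B" for n and B :: "nat \<Rightarrow> 'a config"
    using adv_cost_nonneg[of i w] assms by blast
  show ?thesis by (simp add: adv_cost_add nn)
qed

lemma unserved_infix:
  "unserved i (\<lambda>t. A (t + length xs)) ys \<le> unserved i A (xs @ ys @ zs)"
  by (simp add: unserved_append)

lemma adv_cost_ge_move:
  assumes "\<And>j. j \<in> {1..i} \<Longrightarrow> 0 \<le> w j"
    and "t < n" "j \<in> {1..i}" "A t j \<noteq> A (Suc t) j"
  shows "w j \<le> adv_cost w i n A"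
proof -
  have "w j = udist (w j) (A t j) (A (Suc t) j)" using assms(4) by (simp add: udist_def)
  also have "\<dots> \<le> (\<Sum>j=1..i. udist (w j) (A t j) (A (Suc t) j))"
    by (rule member_le_sum) (use assms in \<open>auto intro: udist_nonneg\<close>)
  also have "\<dots> \<le> adv_cost w i n A"
    unfolding adv_cost_def
    by (rule member_le_sum[of t "{..<n}" "\<lambda>t. \<Sum>j=1..i. udist (w j) (A t j) (A (Suc t) j)"])
      (use assms in \<open>auto intro!: sum_nonneg udist_nonneg\<close>)
  finally show ?thesis .
qed

text \<open>A server that never leaves \<open>p\<close> can only help with requests whose coordinate
  is \<open>p\<close>.\<close>

lemma unserved_parked_server:
  assumes "\<And>t. t < length rs \<Longrightarrow> A (Suc t) (Suc i) = p"
  shows "unserved i A rs \<le> unserved (Suc i) A rs + length (filter (\<lambda>r. r (Suc i) = p) rs)"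
proof -
  have "serves i (A (Suc t)) r \<or> r (Suc i) = p" if "t < length rs" "serves (Suc i) (A (Suc t)) r" for t r
    using that assms[OF that(1)] by (fastforce simp: serves_def le_Suc_eq)
  then have "{t. t < length rs \<and> \<not> serves i (A (Suc t)) (rs ! t)} \<subseteq>
      {t. t < length rs \<and> \<not> serves (Suc i) (A (Suc t)) (rs ! t)} \<union>
      {t. t < length rs \<and> (rs ! t) (Suc i) = p}"
    by blast
  then have "unserved i A rs \<le> card ({t. t < length rs \<and> \<not> serves (Suc i) (A (Suc t)) (rs ! t)} \<union>
      {t. t < length rs \<and> (rs ! t) (Suc i) = p})"
    unfolding unserved_def by (intro card_mono) auto
  also have "\<dots> \<le> unserved (Suc i) A rs + length (filter (\<lambda>r. r (Suc i) = p) rs)"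
    unfolding unserved_def length_filter_conv_card by (rule card_Un_le)
  finally show ?thesis .
qed

section \<open>Counting requests at a point\<close>

lemma sum_filter_eq_le_length:
  assumes "finite S"
  shows "(\<Sum>q\<in>S. length (filter (\<lambda>x. f x = q) xs)) \<le> length xs"
proof (induction xs)
  case (Cons x xs)
  have "(\<Sum>q\<in>S. length (filter (\<lambda>x. f x = q) (x # xs))) =
      (\<Sum>q\<in>S. (if f x = q then 1 else 0) + length (filter (\<lambda>x. f x = q) xs))"
    by (intro sum.cong) auto
  also have "\<dots> \<le> Suc (length xs)"
    using Cons assms by (auto simp: sum.distrib sum.delta')
  finally show ?case by simp
qed simp

text \<open>Each of the \<open>n\<close> points of \<open>P\<close> is requested at least as often
  as \<open>p\<close>, and these \<open>n + 1\<close> classes of requests are disjoint.\<close>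

lemma top_points_count_bound:
  assumes "top_points n X (req_count i t) P" "p \<in> X - P"
  shows "(n + 1) * req_count i t p \<le> length (requests t)"
proof -
  have P: "finite P" "card P = n" "\<forall>q\<in>P. req_count i t p \<le> req_count i t q" "p \<notin> P"
    using assms by (auto simp: top_points_def)
  have "(n + 1) * req_count i t p = (\<Sum>q\<in>insert p P. req_count i t p)"
    using P by simp
  also have "\<dots> \<le> (\<Sum>q\<in>insert p P. req_count i t q)"
    using P by (intro sum_mono) auto
  also have "\<dots> \<le> length (requests t)"
    unfolding req_count_def using P(1) by (intro sum_filter_eq_le_length) simp
  finally show ?thesis .
qed

subsection \<open>The parameters\<close>

text \<open>The exponents satisfy 2^(i+2) - 3 = 2 (2^(i+1) - 3) + 3; the bound by 4 in the proof
  keeps the subtraction of naturals exact.\<close>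

lemma cpar_Suc: "1 \<le> i \<Longrightarrow> real (cpar (Suc i)) = 8 * (real (cpar i))\<^sup>2"
proof -
  assume "1 \<le> i"
  then have "(4::nat) \<le> 2 ^ (i + 1)" using power_increasing[of 2 "i + 1" "2::nat"] by simp
  then have "(2::nat) ^ (Suc i + 1) - 3 = 3 + (2 ^ (i + 1) - 3) * 2" by simp
  then have "cpar (Suc i) = 2 ^ (3 + (2 ^ (i + 1) - 3) * 2)" by (simp only: cpar_def)
  also have "\<dots> = 8 * (cpar i)\<^sup>2" by (simp add: cpar_def power_add power_mult)
  finally show ?thesis by simp
qed

lemma cpar_numerals: "cpar (Suc 0) = 2" "cpar (Suc (Suc 0)) = 32"
  by (simp_all add: cpar_def)

lemma cpar_ge_32: "1 \<le> i \<Longrightarrow> 32 \<le> cpar (Suc i)"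
proof -
  assume "1 \<le> i"
  then have "(2::nat) ^ 3 \<le> 2 ^ (Suc i + 1)" by (intro power_increasing) auto
  then have "(2::nat) ^ 5 \<le> cpar (Suc i)"
    unfolding cpar_def by (intro power_increasing) auto
  then show ?thesis by simp
qed

lemma cpar_pos: "0 < cpar i"
  by (simp add: cpar_def)

lemma Rpar_eq: "Rpar i = 8 * cpar (Suc i)"
proof -
  have "(4::nat) \<le> 2 ^ (i + 2)" using power_increasing[of 2 "i + 2" "2::nat"] by simp
  moreover have "Suc i + 1 = i + 2" by simp
  ultimately have "(2::nat) ^ (i + 2) = 3 + (2 ^ (Suc i + 1) - 3)" by presburger
  then have "Rpar i = 2 ^ (3 + (2 ^ (Suc i + 1) - 3))" by (simp only: Rpar_def)
  then show ?thesis by (simp add: cpar_def power_add)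
qed

lemma Rpar_Suc: "Rpar (Suc i) = Rpar i * Rpar i"
  by (simp add: Rpar_def flip: power_add)

subsection \<open>The first algorithm\<close>

definition chase :: "'p request list \<Rightarrow> 'p trace" where
  "chase rs = concat (map (\<lambda>r. [Request r, Move 1 (r 1)]) rs)"

lemma chase_simps [simp]:
  "chase [] = []" "chase (r # rs) = Request r # Move 1 (r 1) # chase rs"
  "chase (rs @ rs') = chase rs @ chase rs'"
  by (simp_all add: chase_def)

lemma requests_chase [simp]: "requests (chase rs) = rs"
  by (induction rs) auto

lemma alg_phase_1: "alg_phase M w 1 C t \<longleftrightarrow> (\<exists>rs. length rs = 6 \<and> t = chase rs)"
  by (simp add: chase_def)

lemma moves_within_chase: "moves_within 1 (chase rs)"
  by (induction rs) auto

lemma trace_cost_chase_le: "w 1 = 1 \<Longrightarrow> trace_cost w C (chase rs) \<le> real (length rs)"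
proof (induction rs arbitrary: C)
  case (Cons r rs)
  have "trace_cost w (C(1 := r 1)) (chase rs) \<le> real (length rs)" using Cons by blast
  then show ?case using Cons.prems udist_le[of "w 1" "C 1" "r 1"] by auto
qed auto

lemma trace_cost_chase:
  "w 1 = 1 \<Longrightarrow> admissible M 1 C (chase rs) \<Longrightarrow> trace_cost w C (chase rs) = real (length rs)"
proof (induction rs arbitrary: C)
  case (Cons r rs)
  then show ?case by (auto simp: udist_def serves_def)
qed auto

lemma strict_prefix_chase_cost_less:
  "w 1 = 1 \<Longrightarrow> strict_prefix s (chase rs) \<Longrightarrow> trace_cost w C s < real (length rs)"
proof (induction rs arbitrary: C s)
  case (Cons r rs)
  consider "s = []" | "s = [Request r]" |
    s' where "s = Request r # Move 1 (r 1) # s'" "strict_prefix s' (chase rs)"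
    using Cons.prems(2) by (cases s; cases "tl s") auto
  then show ?case
  proof cases
    case 3
    then show ?thesis
      using Cons.IH[OF _ 3(2), of "C(1 := r 1)"] Cons.prems(1) udist_le[of "w 1" "C 1" "r 1"]
      by (auto simp del: fun_upd_apply)
  qed auto
qed auto

text \<open>A cut may separate a request from its move. Dropping the last round gives whole rounds
  that end strictly before \<open>t\<close> does, where the cost is still below the target.\<close>

lemma prefix_chase:
  assumes "prefix t (chase rs)" "t \<noteq> []"
  obtains xs where "strict_prefix (chase xs) t" "length (requests t) = length xs + 1"
proof -
  have "\<exists>xs. strict_prefix (chase xs) t \<and> length (requests t) = length xs + 1"
    using assms
  proof (induction rs arbitrary: t)
    case (Cons r rs)
    consider "t = [Request r]" | "t = [Request r, Move 1 (r 1)]" |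
      t' where "t = Request r # Move 1 (r 1) # t'" "prefix t' (chase rs)" "t' \<noteq> []"
      using Cons.prems by (cases t; cases "tl t"; cases "tl (tl t)") auto
    then show ?case
    proof cases
      case 3
      then obtain xs where "strict_prefix (chase xs) t'" "length (requests t') = length xs + 1"
        using Cons.IH by blast
      then show ?thesis using 3 by (intro exI[of _ "r # xs"]) auto
    qed (auto intro!: exI[of _ "[]"])
  qed auto
  then show thesis using that by blast
qed

lemma phase_seq_1: "phase_seq (alg_phase M w 1) C ts \<Longrightarrow> \<exists>rs. concat ts = chase rs"
proof (induction ts arbitrary: C)
  case Nil
  show ?case by (intro exI[of _ "[]"]) simp
next
  case (Cons t ts)
  have "alg_phase M w 1 C t" using Cons.prems by (simp only: phase_seq.simps)
  then obtain rs where "t = chase rs" unfolding alg_phase_1 by blast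
  moreover obtain rs' where "concat ts = chase rs'" using Cons by auto
  ultimately show ?case by (intro exI[of _ "rs @ rs'"]) simp
qed

subsection \<open>Costs and lengths of phases\<close>

locale weighted_uniform_spaces =
  fixes M :: "nat \<Rightarrow> 'p set" and w :: "nat \<Rightarrow> real" and k :: nat
  assumes w_pos: "j \<in> {1..k} \<Longrightarrow> 0 < w j"
    and w_1: "w 1 = 1"
    and w_mult: "j \<in> {2..k} \<Longrightarrow>
      \<exists>m::int. w j = of_int m * (2 * (1 + real (cpar (j - 1))) * w (j - 1))"
begin

text \<open>The cost if no move is free: \<open>1 + cpar i\<close> subphases, each with a move and a
  run of cost \<open>w i\<close>. For \<open>i = 1\<close> the formula gives 6, the cost of the six
  requests.\<close>

definition phase_cost :: "nat \<Rightarrow> real" where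
  "phase_cost i = 2 * (1 + real (cpar i)) * w i"

text \<open>The number of requests of a run of the \<open>(i - 1)\<close>-st algorithm of cost \<open>w i\<close>, if no movement
  of a server were ever free. In general it is only a lower bound for this number.\<close>

definition subphase_len :: "nat \<Rightarrow> real" where
  "subphase_len i = 4 * w i / 2 ^ i"

text \<open>Note the shift: \<open>run i\<close> is a subphase of the algorithm on level
  \<open>Suc i\<close>.\<close>

abbreviation run :: "nat \<Rightarrow> 'p config \<Rightarrow> 'p trace \<Rightarrow> bool" where
  "run i \<equiv> run_until w (alg_phase M w i) (w (Suc i))"

lemma phase_cost_pos: "1 \<le> i \<Longrightarrow> i \<le> k \<Longrightarrow> 0 < phase_cost i"
  using w_pos[of i] by (simp add: phase_cost_def)

lemma subphase_len_pos: "1 \<le> i \<Longrightarrow> i \<le> k \<Longrightarrow> 0 < subphase_len i"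
  using w_pos[of i] by (simp add: subphase_len_def)

text \<open>\<open>z\<close> is the number of full-price phases in one subphase of the next level.
  The factor 2 in \<open>phase_cost\<close> cancels against the additional halving in
  \<open>subphase_len\<close>.\<close>

lemma w_Suc:
  assumes "1 \<le> i" "Suc i \<le> k"
  obtains z :: nat where "1 \<le> z" "w (Suc i) = real z * phase_cost i"
    "subphase_len (Suc i) = real z * ((1 + real (cpar i)) * subphase_len i)"
proof -
  obtain m :: int where m: "w (Suc i) = of_int m * phase_cost i"
    using w_mult[of "Suc i"] assms by (auto simp: phase_cost_def)
  have "0 < real_of_int m * phase_cost i" using m w_pos[of "Suc i"] assms by simp
  then have "0 < m" using phase_cost_pos[of i] assms by (simp add: zero_less_mult_iff)
  then have *: "1 \<le> nat m" "w (Suc i) = real (nat m) * phase_cost i" using m by auto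
  show thesis
    by (rule that[OF *]) (simp add: subphase_len_def *(2) phase_cost_def)
qed

lemma alg_phase_SucE:
  assumes "alg_phase M w (Suc i) C t" "1 \<le> i"
  obtains a u ps v where "t = Move (Suc i) a # u @ v" "run i (C(Suc i := a)) u"
    "top_points (cpar (Suc i)) (M (Suc i)) (req_count (Suc i) u) (set ps)"
    "distinct ps" "length ps = cpar (Suc i)"
    "visits (Suc i) (run i) ps (after (C(Suc i := a)) u) v"
proof -
  obtain n where n: "i = Suc n" using assms(2) by (cases i) auto
  from assms(1) show thesis
    unfolding n alg_phase.simps(3) Let_def
  proof (elim exE conjE)
    fix a u P ps v
    assume *: "t = Move (Suc (Suc n)) a # u @ v"
      "run_until w (alg_phase M w (Suc n)) (w (Suc (Suc n))) (C(Suc (Suc n) := a)) u"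
      "top_points (cpar (Suc (Suc n))) (M (Suc (Suc n))) (req_count (Suc (Suc n)) u) P"
      "distinct ps" "set ps = P"
      "visits (Suc (Suc n)) (run_until w (alg_phase M w (Suc n)) (w (Suc (Suc n)))) ps
        (after (C(Suc (Suc n) := a)) u) v"
    have "length ps = card (set ps)" using *(4) by (simp add: distinct_card)
    then have "length ps = cpar (Suc (Suc n))" using *(3,5) by (simp add: top_points_def)
    then show thesis using that[unfolded n, OF *(1,2) *(3)[folded *(5)] *(4) _ *(6)] by simp
  qed
qed

text \<open>The learning subphase becomes the first visit. Since its point may lie in
  \<open>P\<close>, the resulting list need not be distinct, which suffices for upper bounds on cost
  and for both bounds on length.\<close>

lemma alg_phase_visits:
  assumes "alg_phase M w (Suc i) C t" "1 \<le> i"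
  obtains ps where "visits (Suc i) (run i) ps C t" "length ps = 1 + cpar (Suc i)"
proof (rule alg_phase_SucE[OF assms])
  fix a u ps v
  assume *: "t = Move (Suc i) a # u @ v" "run i (C(Suc i := a)) u"
    "length ps = cpar (Suc i)" "visits (Suc i) (run i) ps (after (C(Suc i := a)) u) v"
  then have "visits (Suc i) (run i) (a # ps) C t" unfolding visits.simps by blast
  then show thesis by (rule that) (simp add: *(3))
qed

lemma alg_phase_moves_within: "alg_phase M w i C t \<Longrightarrow> moves_within i t"
proof (induction i arbitrary: C t)
  case (Suc i)
  show ?case
  proof (cases "1 \<le> i")
    case True
    then obtain ps where "visits (Suc i) (run i) ps C t"
      using alg_phase_visits Suc.prems by blast
    moreover have "moves_within (Suc i) t" if "run i C t" for C t
    proof -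
      have "moves_within i t" by (rule moves_within_run_until[OF _ that]) (rule Suc.IH)
      then show ?thesis by (rule moves_within_mono) simp
    qed
    ultimately show ?thesis using moves_within_visits by blast
  next
    case False
    then have "Suc i = 1" by simp
    then obtain rs where "t = chase rs" using Suc.prems alg_phase_1[of M w C t] by metis
    then show ?thesis using moves_within_chase \<open>Suc i = 1\<close> by metis
  qed
qed simp

lemma run_moves_within: "run i C t \<Longrightarrow> moves_within i t"
  using alg_phase_moves_within by (rule moves_within_run_until)

lemma run_cost: "run i C t \<Longrightarrow> trace_cost w C t = w (Suc i)"
  and run_strict_prefix_cost: "run i C t \<Longrightarrow> strict_prefix s t \<Longrightarrow> trace_cost w C s < w (Suc i)"
  by (auto simp: run_until_def)

lemma run_after: "run i C t \<Longrightarrow> after C t (Suc i) = C (Suc i)"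
  by (rule after_moves_within[OF run_moves_within]) auto

section \<open>Bounds on costs of phases\<close>

lemma alg_phase_cost_bounds:
  assumes "alg_phase M w i C t" "1 \<le> i" "i \<le> k"
  shows alg_phase_cost_le: "trace_cost w C t \<le> phase_cost i"
    and strict_prefix_alg_phase_cost_less: "strict_prefix s t \<Longrightarrow> trace_cost w C s < phase_cost i"
proof -
  have "trace_cost w C t \<le> phase_cost i \<and>
      (strict_prefix s t \<longrightarrow> trace_cost w C s < phase_cost i)"
  proof (cases "i = 1")
    case True
    then obtain rs where rs: "length rs = 6" "t = chase rs"
      using assms alg_phase_1 by blast
    have "phase_cost i = real (length rs)"
      using True rs w_1 by (simp add: phase_cost_def cpar_numerals)
    then show ?thesis
      using rs trace_cost_chase_le[of w C rs] strict_prefix_chase_cost_less[of w s rs C] w_1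
      by simp
  next
    case False
    then obtain n where n: "i = Suc n" "1 \<le> n" using assms by (cases i) auto
    then obtain ps where ps: "visits i (run n) ps C t" "length ps = 1 + cpar i"
      using alg_phase_visits assms by blast
    have "phase_cost i = 2 * real (length ps) * w i" by (simp add: phase_cost_def ps)
    moreover have w: "0 < w i" using w_pos assms by simp
    moreover have "trace_cost w C t \<le> 2 * real (length ps) * w i"
      by (rule visits_cost_le[where run = "run n" and w = w and i = i, OF _ w ps(1)]) (simp add: run_cost n(1))
    moreover have "trace_cost w C s < 2 * real (length ps) * w i" if "strict_prefix s t"
      by (rule visits_strict_prefix_cost_less[where run = "run n" and w = w and i = i,
          OF _ _ w ps(1) that])
        (simp_all add: run_cost run_strict_prefix_cost n(1))
    ultimately show ?thesis by simp
  qed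
  then show "trace_cost w C t \<le> phase_cost i"
    "strict_prefix s t \<Longrightarrow> trace_cost w C s < phase_cost i" by auto
qed

text \<open>At most two moves are free: the one to \<open>a\<close>, and the one to the first point
  of \<open>ps\<close>. So at most \<open>2 * w (Suc i)\<close> is saved compared with
  \<open>phase_cost\<close>.\<close>

lemma alg_phase_cost_ge:
  assumes "alg_phase M w (Suc i) C t" "1 \<le> i" "Suc i \<le> k"
  shows "2 * real (cpar (Suc i)) * w (Suc i) \<le> trace_cost w C t"
proof -
  obtain a u ps v where *: "t = Move (Suc i) a # u @ v" "run i (C(Suc i := a)) u"
    "top_points (cpar (Suc i)) (M (Suc i)) (req_count (Suc i) u) (set ps)"
    "distinct ps" "length ps = cpar (Suc i)"
    "visits (Suc i) (run i) ps (after (C(Suc i := a)) u) v"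
    by (rule alg_phase_SucE[OF assms(1,2)])
  have "(2 * real (length ps) - 1) * w (Suc i) \<le> trace_cost w (after (C(Suc i := a)) u) v"
    by (rule visits_cost_ge[where run = "run i" and i = "Suc i", OF run_cost run_after _ *(6,4)]) (use w_pos assms in auto)
  moreover have "0 \<le> udist (w (Suc i)) (C (Suc i)) a"
    using w_pos[of "Suc i"] assms by (intro udist_nonneg) auto
  ultimately show ?thesis using * run_cost[OF *(2)] by (simp add: trace_append algebra_simps)
qed

lemma phase_seq_cost_le:
  assumes "phase_seq (alg_phase M w i) C ts" "1 \<le> i" "i \<le> k"
  shows "trace_cost w C (concat ts) \<le> real (length ts) * phase_cost i"
  using assms(1)
proof (induction ts arbitrary: C)
  case (Cons t ts)
  then have "trace_cost w (after C t) (concat ts) \<le> real (length ts) * phase_cost i"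
    by (intro Cons.IH) simp
  moreover have "trace_cost w C t \<le> phase_cost i"
    using alg_phase_cost_le[OF _ assms(2,3)] Cons.prems by simp
  ultimately show ?case by (simp add: trace_append algebra_simps)
qed simp

text \<open>The unfinished rest costs less than \<open>phase_cost i\<close>, so fewer than
  \<open>z\<close> complete phases could not add up to \<open>w (Suc i)\<close>.\<close>

lemma run_complete_phases:
  assumes "run i C t" "1 \<le> i" "Suc i \<le> k" "w (Suc i) = real z * phase_cost i"
  obtains ts s where "t = concat ts @ s" "phase_seq (alg_phase M w i) C ts" "z \<le> length ts"
proof -
  have k: "i \<le> k" using assms(3) by simp
  obtain ts s where *: "t = concat ts @ s" "phase_seq (alg_phase M w i) C ts"
    "s = [] \<or> (\<exists>u. alg_phase M w i (after C (concat ts)) u \<and> strict_prefix s u)"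
    using run_until_split[OF assms(1)] by blast
  have pos: "0 < phase_cost i" using phase_cost_pos assms(2) k by blast
  then have "trace_cost w (after C (concat ts)) s < phase_cost i"
    using *(3) strict_prefix_alg_phase_cost_less[OF _ assms(2) k] by auto
  then have "real z * phase_cost i < (real (length ts) + 1) * phase_cost i"
    using run_cost[OF assms(1)] * phase_seq_cost_le[OF *(2) assms(2) k] assms(4)
    by (simp add: trace_append algebra_simps)
  then have "real z < real (length ts) + 1" using pos by simp
  then have "z \<le> length ts" by linarith
  then show thesis using that * by blast
qed

section \<open>Bounds on numbers of requests\<close>

lemma run_length_ge:
  assumes "\<And>C t. alg_phase M w i C t \<Longrightarrow> admissible M i C t \<Longrightarrow>
      (1 + real (cpar i)) * subphase_len i \<le> real (length (requests t))"
    and "1 \<le> i" "Suc i \<le> k" "run i C t" "admissible M i C t"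
  shows "subphase_len (Suc i) \<le> real (length (requests t))"
proof -
  let ?L = "(1 + real (cpar i)) * subphase_len i"
  obtain z :: nat where z: "w (Suc i) = real z * phase_cost i" "subphase_len (Suc i) = real z * ?L"
    using w_Suc assms(2,3) by metis
  obtain ts s where ts: "t = concat ts @ s" "phase_seq (alg_phase M w i) C ts" "z \<le> length ts"
    using run_complete_phases[OF assms(4,2,3) z(1)] by blast
  have *: "real (length ts) * ?L \<le> real (length (requests (concat ts)))"
    if "phase_seq (alg_phase M w i) C ts" "admissible M i C (concat ts)" for C ts
    using that
  proof (induction ts arbitrary: C)
    case (Cons t ts)
    then have "real (length ts) * ?L \<le> real (length (requests (concat ts)))"
      by (intro Cons.IH[of "after C t"]) (auto simp: admissible_append)
    moreover have "?L \<le> real (length (requests t))"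
      using assms(1)[of C t] Cons.prems by (auto simp: admissible_append)
    ultimately show ?case by (simp add: requests_append algebra_simps)
  qed simp
  have "0 \<le> ?L" using subphase_len_pos[of i] assms(2,3) by simp
  then have "real z * ?L \<le> real (length ts) * ?L" using ts(3) by (intro mult_right_mono) auto
  moreover have "admissible M i C (concat ts)" using assms(5) ts(1) by (simp add: admissible_append)
  then have "real (length ts) * ?L \<le> real (length (requests (concat ts)))" using *[OF ts(2)] by simp
  moreover have "length (requests (concat ts)) \<le> length (requests t)"
    using ts(1) by (simp add: requests_append)
  ultimately show ?thesis unfolding z(2) by linarith
qed

lemma alg_phase_length_ge:
  assumes "alg_phase M w i C t" "admissible M i C t" "1 \<le> i" "i \<le> k"
  shows "(1 + real (cpar i)) * subphase_len i \<le> real (length (requests t))"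
  using assms(3,1,2,4)
proof (induction i arbitrary: C t rule: nat_induct_at_least)
  case base
  then obtain rs where "length rs = 6" "t = chase rs" unfolding alg_phase_1 by blast
  then show ?case using w_1 by (simp add: subphase_len_def cpar_numerals)
next
  case (Suc i)
  obtain ps where ps: "visits (Suc i) (run i) ps C t" "length ps = 1 + cpar (Suc i)"
    using alg_phase_visits Suc.prems(1) Suc.hyps by blast
  have "subphase_len (Suc i) \<le> real (length (requests t))"
    if "run i C t" "admissible M (Suc i) C t" for C t
    using run_length_ge[OF Suc.IH _ _ that(1)] admissible_antimono[OF that(2)] Suc.hyps Suc.prems(3)
    by simp
  from visits_length_ge[where run = "run i", OF this ps(1) Suc.prems(2)]
  show ?case using ps(2) by simp
qed

text \<open>Here \<open>n\<close> is the number of complete phases and \<open>j\<close> that of the further complete subphases in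
  a run, and costs are measured in units of \<open>w i\<close>. A phase has \<open>1 + c\<close> subphases and costs at least
  \<open>2 c\<close>. Integrality matters: over the reals, \<open>z = 1\<close>, \<open>n < 1\<close> would only give about \<open>3 c / 2\<close>.\<close>

lemma complete_phases_arith:
  fixes n j z c :: nat
  assumes "n * (2 * c) + j < z * (2 * (1 + c))" "j \<le> c" "1 \<le> c"
  shows "n * (1 + c) + j + 1 \<le> z * (c + 4)"
proof (cases "n < z")
  case True
  then have "(n + 1) * (1 + c) \<le> z * (1 + c)" by (intro mult_right_mono) auto
  also have "\<dots> \<le> z * (c + 4)" by (intro mult_left_mono) auto
  finally show ?thesis using assms(2) by simp
next
  case False
  \<comment> \<open>For \<open>n = z + d\<close> the hypothesis reduces to 2 d c + j < 2 z, so the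
    excess d + d c + j + 1 is at most 2 z.\<close>
  then obtain d where d: "n = z + d" using le_Suc_ex not_less by blast
  have "d \<le> d * c" using assms(3) by simp
  moreover have "j + 2 * (d * c) < 2 * z" using assms(1) d by (simp add: algebra_simps)
  moreover have "n * (1 + c) + j + 1 = z * (1 + c) + d + d * c + j + 1"
    "z * (c + 4) = z * (1 + c) + 3 * z" using d by (simp_all add: algebra_simps)
  ultimately show ?thesis by linarith
qed

text \<open>The term \<open>8 / c\<close> makes the bound strong enough for the induction: passing to the next level
  costs a factor \<open>(c + 4) / (c + 1)\<close>. It is sharp for \<open>i = 1\<close>, where \<open>cpar 2 = 32\<close>.\<close>

lemma cut_run_length_le:
  assumes "1 \<le> i" "Suc i \<le> k" "cut_run w (alg_phase M w i) (w (Suc i)) C t" "admissible M i C t"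
  shows "real (length (requests t)) \<le> (5/4 - 8 / real (cpar (Suc i))) * subphase_len (Suc i)"
  using assms
proof (induction i arbitrary: C t rule: nat_induct_at_least)
  case base
  obtain z :: nat where z: "w (Suc 1) = real z * phase_cost 1"
    using w_Suc base.prems(1) by blast
  then have w2: "w (Suc 1) = real (6 * z)"
    using w_1 by (simp add: phase_cost_def cpar_numerals)
  obtain rs where rs: "prefix t (chase rs)"
    using base.prems(2) phase_seq_1 unfolding cut_run_def by metis
  have "length (requests t) \<le> 6 * z"
  proof (cases "t = []")
    case False
    then obtain xs where xs: "strict_prefix (chase xs) t" "length (requests t) = length xs + 1"
      using prefix_chase rs by blast
    have "admissible M 1 C (chase xs)"
      using xs(1) base.prems(3) by (auto simp: strict_prefix_def prefix_def admissible_append)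
    then have "real (length xs) < w (Suc 1)"
      using trace_cost_chase[of w M C xs] w_1 base.prems(2) xs(1) unfolding cut_run_def by metis
    then show ?thesis using xs(2) w2 by linarith
  qed simp
  then have "real (length (requests t)) \<le> w (Suc 1)" using w2 by linarith
  then show ?case by (simp add: subphase_len_def cpar_numerals)
next
  case (Suc n)
  define i where "i = Suc n"
  let ?c = "cpar i"
  define b where "b = (5/4 - 8 / real ?c) * subphase_len i"
  have i: "1 \<le> i" "i \<le> k" "Suc i \<le> k" "0 < w i" using Suc.prems(1) w_pos[of i] by (auto simp: i_def)
  have c: "32 \<le> ?c" using cpar_ge_32[OF Suc.hyps(1)] by (simp add: i_def)
  have N: "0 < subphase_len i" using subphase_len_pos i by blast
  obtain z :: nat where z: "1 \<le> z" "w (Suc i) = real z * phase_cost i"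
    "subphase_len (Suc i) = real z * ((1 + real ?c) * subphase_len i)"
    using w_Suc i by blast
  \<comment> \<open>The induction hypothesis is about cut runs, so it also covers the subphase in
    which the run is stopped.\<close>
  have sub: "real (length (requests s)) \<le> b"
    if "run n C t" "prefix s t" "admissible M i C s" for C t s
    using Suc.IH[OF _ cut_run_prefix[OF that(1,2)]] admissible_antimono[OF that(3), of n] i
    by (simp add: i_def b_def)
  have run: "trace_cost w C t = w i" if "run n C t" for C t
    using run_cost[OF that] by (simp add: i_def)
  have b: "0 \<le> b" unfolding b_def using N c by (intro mult_nonneg_nonneg) (auto simp: field_simps)
  have phases: "real (length ts) * (2 * real ?c * w i) \<le> trace_cost w C (concat ts) \<and>
      real (length (requests (concat ts))) \<le> real (length ts) * ((1 + real ?c) * b)"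
    if "phase_seq (alg_phase M w i) C ts" "admissible M i C (concat ts)" for C ts
    using that
  proof (induction ts arbitrary: C)
    case (Cons t ts)
    have t: "alg_phase M w i C t" "admissible M i C t" using Cons.prems by (auto simp: trace_append)
    obtain ps where ps: "visits i (run n) ps C t" "length ps = 1 + ?c"
      using alg_phase_visits t Suc.hyps unfolding i_def by blast
    have "real (length (requests t)) \<le> real (length ps) * b"
      by (rule visits_length_le[where run = "run n", OF _ ps(1) t(2)]) (use sub in auto)
    moreover have "2 * real ?c * w i \<le> trace_cost w C t"
      using alg_phase_cost_ge t Suc.hyps i unfolding i_def by blast
    moreover have "real (length ts) * (2 * real ?c * w i) \<le> trace_cost w (after C t) (concat ts) \<and>
        real (length (requests (concat ts))) \<le> real (length ts) * ((1 + real ?c) * b)"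
      by (intro Cons.IH) (use Cons.prems in \<open>auto simp: admissible_append\<close>)
    ultimately show ?case using ps(2) by (simp add: trace_append algebra_simps)
  qed simp
  have "real (length (requests t)) \<le> real (z * (?c + 4)) * b"
  proof (cases "t = []")
    case False
    obtain us where "phase_seq (alg_phase M w i) C us" "prefix t (concat us)"
      using Suc.prems(2) by (auto simp: cut_run_def i_def)
    then obtain ts s u where *: "t = concat ts @ s" "phase_seq (alg_phase M w i) C ts"
      "alg_phase M w i (after C (concat ts)) u" "prefix s u" "s \<noteq> []"
      by (rule prefix_phase_seq[OF _ _ False])
    obtain ps where ps: "visits i (run n) ps (after C (concat ts)) u" "length ps = 1 + ?c"
      using alg_phase_visits *(3) Suc.hyps unfolding i_def by blast
    have adm: "admissible M i C (concat ts)" "admissible M i (after C (concat ts)) s"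
      using Suc.prems(3) * by (auto simp: admissible_append i_def)
    obtain j s' where j: "j < length ps" "strict_prefix s' s"
      "real j * w i \<le> trace_cost w (after C (concat ts)) s'"
      "real (length (requests s)) \<le> real (j + 1) * b"
      by (rule visits_prefix_length[where run = "run n" and w = w and i = i and b = b, OF run i(4) sub ps(1) *(4,5) adm(2)])
    \<comment> \<open>At this moment the target cost is not yet reached. Dividing by
      \<open>w i\<close> leaves a strict inequality between naturals.\<close>
    have "strict_prefix (concat ts @ s') t" using j(2) * by (auto simp: strict_prefix_def)
    then have "trace_cost w C (concat ts @ s') < w (Suc i)"
      using Suc.prems(2) by (auto simp: cut_run_def i_def)
    then have "real (length ts * (2 * ?c) + j) * w i < real (z * (2 * (1 + ?c))) * w i"
      using phases[OF *(2) adm(1)] j(3) z(2)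
      by (simp add: trace_append phase_cost_def algebra_simps)
    then have "length ts * (2 * ?c) + j < z * (2 * (1 + ?c))"
      using i(4) by (simp only: mult_less_cancel_right_pos of_nat_less_iff)
    then have "length ts * (1 + ?c) + j + 1 \<le> z * (?c + 4)"
      using complete_phases_arith j(1) ps(2) c by simp
    then have "real (length ts * (1 + ?c) + j + 1) * b \<le> real (z * (?c + 4)) * b"
      using b by (intro mult_right_mono) (auto simp only: of_nat_le_iff)
    moreover have "real (length (requests t)) \<le> real (length ts * (1 + ?c) + j + 1) * b"
      using phases[OF *(2) adm(1)] j(4) * by (simp add: requests_append algebra_simps)
    ultimately show ?thesis by linarith
  qed (use b in simp)
  also have "\<dots> = real z * subphase_len i * ((real ?c + 4) * (5/4 - 8 / real ?c))"
    by (simp add: b_def ac_simps)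
  \<comment> \<open>On the left, the term 8 / c yields -8 and absorbs the +5 coming from 4 * 5/4. On
    the right, 8 / \<open>cpar (Suc i)\<close> = 1 / c^2, and (1 + c) / c^2 is at most 5/4.\<close>
  also have "\<dots> \<le> real z * subphase_len i * ((5/4 - 8 / real (cpar (Suc i))) * (1 + real ?c))"
  proof (rule mult_left_mono)
    have "(real ?c + 4) * (5/4 - 8 / real ?c) = 5/4 * real ?c - 3 - 32 / real ?c"
      using c by (simp add: field_simps)
    also have "\<dots> \<le> 5/4 * real ?c"
    proof -
      have "0 \<le> 32 / real ?c" by simp
      then show ?thesis by linarith
    qed
    also have "\<dots> \<le> (5/4 - 8 / real (cpar (Suc i))) * (1 + real ?c)"
    proof -
      have "32 * real ?c \<le> (real ?c)\<^sup>2" using c by (simp add: power2_eq_square mult_right_mono)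
      then have "1 + real ?c \<le> 5/4 * (real ?c)\<^sup>2" using c by linarith
      then have "(1 + real ?c) / (real ?c)\<^sup>2 \<le> 5/4" using c by (simp add: divide_le_eq)
      then show ?thesis using cpar_Suc[OF i(1)] by (simp add: algebra_simps add_divide_distrib)
    qed
    finally show "(real ?c + 4) * (5/4 - 8 / real ?c) \<le> (5/4 - 8 / real (cpar (Suc i))) * (1 + real ?c)" .
  qed (use N in simp)
  finally show ?case unfolding i_def[symmetric] z(3) by (simp only: ac_simps)
qed

lemma run_length_le:
  assumes "run i C t" "admissible M i C t" "1 \<le> i" "Suc i \<le> k"
  shows "real (length (requests t)) \<le> 5/4 * subphase_len (Suc i)"
proof -
  have "real (length (requests t)) \<le> (5/4 - 8 / real (cpar (Suc i))) * subphase_len (Suc i)"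
    using cut_run_length_le[OF assms(3,4) cut_run_prefix[OF assms(1)] assms(2)] by simp
  also have "\<dots> \<le> 5/4 * subphase_len (Suc i)"
    using subphase_len_pos[of "Suc i"] assms(4) by (intro mult_right_mono) auto
  finally show ?thesis .
qed

lemma alg_phase_length_le:
  assumes "alg_phase M w (Suc i) C t" "admissible M (Suc i) C t" "1 \<le> i" "Suc i \<le> k"
  shows "real (length (requests t)) \<le> (1 + real (cpar (Suc i))) * (5/4 * subphase_len (Suc i))"
proof -
  obtain ps where ps: "visits (Suc i) (run i) ps C t" "length ps = 1 + cpar (Suc i)"
    using alg_phase_visits assms by blast
  have "real (length (requests t)) \<le> 5/4 * subphase_len (Suc i)"
    if "run i C t" "admissible M (Suc i) C t" for C t
    using run_length_le[OF that(1) admissible_antimono[OF that(2)]] assms by simp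
  from visits_length_le[where run = "run i", OF this ps(1) assms(2)]
  show ?thesis using ps(2) by simp
qed

subsection \<open>Competitiveness\<close>

text \<open>The allowance \<open>few\<close> is half of what would let the adversary fail the bound
  of the induction hypothesis in all \<open>z\<close> guaranteed phases; the other half must be paid
  in movement.\<close>

lemma run_competitive:
  assumes IH: "\<And>C t A. alg_phase M w i C t \<Longrightarrow> admissible M i C t \<Longrightarrow>
      real (unserved i A (requests t)) \<le> 4 / real (cpar (Suc i)) * real (length (requests t)) \<Longrightarrow>
      phase_cost i \<le> real (Rpar i) * adv_cost w i (length (requests t)) A"
    and i: "1 \<le> i" "Suc i \<le> k"
    and t: "run i C t" "admissible M i C t"
    and few: "real (cpar (Suc i)) * real (unserved i A (requests t)) \<le> 2 * subphase_len (Suc i)"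
  shows "w (Suc i) \<le> 2 * real (Rpar i) * adv_cost w i (length (requests t)) A"
proof -
  define L where "L = (1 + real (cpar i)) * subphase_len i"
  define P where "P = phase_cost i"
  have L: "0 < L" using subphase_len_pos[of i] i by (simp add: L_def)
  have P: "0 < P" using phase_cost_pos[of i] i by (simp add: P_def)
  obtain z :: nat where z: "w (Suc i) = real z * P" "subphase_len (Suc i) = real z * L"
    using w_Suc[OF i] unfolding P_def L_def by metis
  obtain ts s where ts: "t = concat ts @ s" "phase_seq (alg_phase M w i) C ts" "z \<le> length ts"
    using run_complete_phases[OF t(1) i z(1)[unfolded P_def]] by blast
  \<comment> \<open>\<open>G\<close> is additive over the phases, and at least \<open>4 P L\<close> on each of them: either the induction
    hypothesis applies or more than \<open>4 L / c\<close> requests are not served.\<close>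
  define G where "G A rs = 4 * L * (real (Rpar i) * adv_cost w i (length rs) A) +
      P * (real (cpar (Suc i)) * real (unserved i A rs))" for A :: "nat \<Rightarrow> 'p config" and rs
  have wnn: "0 \<le> w j" if "j \<in> {1..i}" for j
    using w_pos[of j] that i by simp
  have adv_nn: "0 \<le> real (Rpar i) * adv_cost w i n A" for n and A :: "nat \<Rightarrow> 'p config"
    by (intro mult_nonneg_nonneg of_nat_0_le_iff adv_cost_nonneg wnn)
  have G_append: "G A (xs @ ys) = G A xs + G (\<lambda>t. A (t + length xs)) ys" for A xs ys
    by (simp add: G_def unserved_append adv_cost_add algebra_simps)
  have G_nonneg: "0 \<le> G A rs" for A rs
  proof -
    have "0 \<le> 4 * L * (real (Rpar i) * adv_cost w i (length rs) A)"
      by (rule mult_nonneg_nonneg[OF _ adv_nn]) (use L in simp)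
    then show ?thesis unfolding G_def using P by simp
  qed
  have G_phase: "P * (4 * L) \<le> G A (requests t)"
    if t: "alg_phase M w i C t" "admissible M i C t" for C t A
  proof (cases "real (unserved i A (requests t)) \<le>
      4 / real (cpar (Suc i)) * real (length (requests t))")
    case True
    then have "4 * L * P \<le> 4 * L * (real (Rpar i) * adv_cost w i (length (requests t)) A)"
      using IH[OF t True] L by (simp add: P_def)
    then show ?thesis using P by (simp add: G_def add_increasing2 mult.commute)
  next
    case False
    then have "4 * real (length (requests t)) \<le> real (cpar (Suc i)) * real (unserved i A (requests t))"
      using cpar_pos[of "Suc i"] by (simp add: field_simps)
    then have "4 * L \<le> real (cpar (Suc i)) * real (unserved i A (requests t))"
      using alg_phase_length_ge[OF t i(1)] i(2) by (simp add: L_def)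
    then have "P * (4 * L) \<le> P * (real (cpar (Suc i)) * real (unserved i A (requests t)))"
      using P by simp
    then show ?thesis unfolding G_def using adv_nn L by (simp add: add_increasing)
  qed
  have "real (length ts) * (P * (4 * L)) \<le> G A (requests (concat ts))"
    if "phase_seq (alg_phase M w i) C ts" "admissible M i C (concat ts)" for C ts A
    using that
  proof (induction ts arbitrary: C A)
    case (Cons t ts)
    then have "real (length ts) * (P * (4 * L)) \<le>
        G (\<lambda>s. A (s + length (requests t))) (requests (concat ts))"
      by (intro Cons.IH[of "after C t"]) (auto simp: admissible_append)
    moreover have "P * (4 * L) \<le> G A (requests t)"
      using G_phase[of C t] Cons.prems by (auto simp: admissible_append)
    moreover have "real (length (t # ts)) * (P * (4 * L)) = P * (4 * L) + real (length ts) * (P * (4 * L))"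
      by (simp add: algebra_simps)
    moreover have "G A (requests (concat (t # ts))) =
        G A (requests t) + G (\<lambda>s. A (s + length (requests t))) (requests (concat ts))"
      by (simp add: requests_append G_append)
    ultimately show ?case by linarith
  qed (simp add: G_nonneg)
  from this[OF ts(2)] have "real (length ts) * (P * (4 * L)) \<le> G A (requests (concat ts))"
    using t(2) ts(1) by (simp add: admissible_append)
  also have "\<dots> \<le> G A (requests t)"
    using ts(1) G_nonneg by (simp add: requests_append G_append)
  finally have "real (length ts) * (P * (4 * L)) \<le> G A (requests t)" .
  moreover have "real z * (P * (4 * L)) \<le> real (length ts) * (P * (4 * L))"
    using ts(3) P L by (intro mult_right_mono) auto
  ultimately have "real z * (P * (4 * L)) \<le> G A (requests t)" by linarith
  \<comment> \<open>By \<open>few\<close>, unserved requests account for at most 2 z P L of the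
    required 4 z P L. This halving is the factor 2 in the conclusion.\<close>
  also have "\<dots> \<le> 4 * L * (real (Rpar i) * adv_cost w i (length (requests t)) A) + P * (2 * (real z * L))"
    unfolding G_def using few P z(2) by simp
  finally have "(2 * L) * (real z * P) \<le>
      (2 * L) * (2 * real (Rpar i) * adv_cost w i (length (requests t)) A)"
    by (simp add: algebra_simps)
  then show ?thesis using L z(1) by (simp add: ac_simps)
qed

lemma alg_phase_1_competitive:
  assumes "alg_phase M w 1 C t" "admissible M 1 C t"
    and "real (unserved 1 A (requests t)) \<le> 4 / real (cpar (Suc 1)) * real (length (requests t))"
  shows "phase_cost 1 \<le> real (Rpar 1) * adv_cost w 1 (length (requests t)) A"
proof -
  obtain rs where rs: "length rs = 6" "t = chase rs" using assms(1) unfolding alg_phase_1 by blast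
  \<comment> \<open>The allowance is 4/32 * 6 = 3/4, so no request may be ignored.\<close>
  have "real (unserved 1 A rs) < 1" using assms(3) rs by (simp add: cpar_numerals)
  then have "unserved 1 A rs = 0" by simp
  then have served: "serves 1 (A (Suc s)) (rs ! s)" if "s < length rs" for s
    using that unfolding unserved_def by auto
  obtain r r' rs' where r: "rs = r # r' # rs'"
    using rs(1) by (metis Suc_length_conv eval_nat_numeral(2) semiring_norm(26) numeral_eq_Suc)
  \<comment> \<open>When \<open>r'\<close> arrives, the algorithm stands on \<open>r 1\<close>.
    Hence the adversary, serving both requests, has to move in between.\<close>
  then have "r' 1 \<noteq> r 1" using assms(2) rs(2) by (auto simp: serves_def)
  moreover have "A 1 1 = r 1" "A (Suc 1) 1 = r' 1"
    using served[of 0] served[of 1] r by (auto simp: serves_def)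
  ultimately have "w 1 \<le> adv_cost w 1 (length rs) A"
    using rs(1) w_1 by (intro adv_cost_ge_move[of 1 w 1]) auto
  then show ?thesis using w_1 rs by (simp add: phase_cost_def cpar_numerals Rpar_eq)
qed

text \<open>Stated for arbitrary \<open>C\<close> and \<open>A\<close>, because the phases inside a
  subphase start wherever the algorithm and the adversary happen to be.\<close>

lemma alg_phase_competitive:
  assumes "1 \<le> i" "i \<le> k" "alg_phase M w i C t" "admissible M i C t"
    and "real (unserved i A (requests t)) \<le> 4 / real (cpar (Suc i)) * real (length (requests t))"
  shows "phase_cost i \<le> real (Rpar i) * adv_cost w i (length (requests t)) A"
  using assms
proof (induction i arbitrary: C t A rule: nat_induct_at_least)
  case base
  then show ?case using alg_phase_1_competitive by blast
next
  case (Suc i)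
  define n where "n = Suc i"
  define N where "N = subphase_len n"
  define c where "c = real (cpar n)"
  let ?rs = "requests t"
  have i: "1 \<le> i" "Suc i \<le> k" "n \<le> k" "1 \<le> n" using Suc.hyps Suc.prems(1) by (auto simp: n_def)
  have c: "32 \<le> c" using cpar_ge_32[OF i(1)] by (simp add: n_def c_def)
  have N: "0 < N" using subphase_len_pos i by (simp add: N_def)
  have wnn: "0 \<le> w j" if "j \<in> {1..n}" for j
    using w_pos[of j] that i by simp
  have wn: "0 < w n" using w_pos i by simp
  have R: "real (Rpar i) = 8 * c" "real (Rpar n) = 8 * c * (8 * c)"
    using Rpar_eq[of i] Rpar_Suc[of i] by (simp_all add: c_def n_def)
  have cost: "phase_cost n = 2 * (1 + c) * w n" by (simp add: phase_cost_def c_def)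
  have t: "alg_phase M w n C t" "admissible M n C t"
    and few: "real (unserved n A ?rs) \<le> 4 / real (cpar (Suc n)) * real (length ?rs)"
    using Suc.prems by (simp_all add: n_def)
  have "phase_cost n \<le> real (Rpar n) * adv_cost w n (length ?rs) A"
  proof (cases "\<exists>s<length ?rs. A s n \<noteq> A (Suc s) n")
    case True
    then obtain s where "s < length ?rs" "A s n \<noteq> A (Suc s) n" by blast
    then have "w n \<le> adv_cost w n (length ?rs) A"
      using wnn i(4) by (intro adv_cost_ge_move[of n w s]) auto
    then have "real (Rpar n) * w n \<le> real (Rpar n) * adv_cost w n (length ?rs) A"
      by (intro mult_left_mono) auto
    moreover have "phase_cost n \<le> real (Rpar n) * w n"
    proof -
      have "2 * (1 + c) \<le> 8 * c" using c by simp
      also have "\<dots> \<le> 8 * c * (8 * c)" using c by simp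
      finally show ?thesis
        unfolding cost R using wn by (intro mult_right_mono) auto
    qed
    ultimately show ?thesis by linarith
  next
    case False
    define p where "p = A 0 n"
    have parked: "A s n = p" if "s \<le> length ?rs" for s
      using that False by (induction s) (auto simp: p_def)
    \<comment> \<open>All failures of the whole phase are charged to one subphase. This is
      affordable since \<open>cpar (Suc n)\<close> is 8 c^2, while the phase has at most (1 + c) *
      5/4 * N requests and 1 + c is at most 33/32 c.\<close>
    have ignored: "c * real (unserved n A ?rs) \<le> 11/16 * N"
    proof -
      have "real (length ?rs) \<le> (1 + c) * (5/4 * N)"
        using alg_phase_length_le t i unfolding n_def N_def c_def by blast
      also have "\<dots> \<le> (33/32 * c) * (5/4 * N)" using c N by (intro mult_right_mono) auto
      finally have len: "real (length ?rs) \<le> (33/32 * c) * (5/4 * N)" .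
      have "c * real (unserved n A ?rs) \<le> c * (4 / (8 * c\<^sup>2) * real (length ?rs))"
        using few c cpar_Suc[OF i(4)] by (intro mult_left_mono) (auto simp: c_def)
      also have "\<dots> \<le> c * (4 / (8 * c\<^sup>2) * ((33/32 * c) * (5/4 * N)))"
        using len c by (intro mult_left_mono) auto
      also have "\<dots> = 165/256 * N" using c by (simp add: power2_eq_square)
      finally show ?thesis using N by linarith
    qed
    obtain a u ps v where *: "t = Move (Suc i) a # u @ v" "run i (C(Suc i := a)) u"
      "top_points (cpar (Suc i)) (M (Suc i)) (req_count (Suc i) u) (set ps)"
      "distinct ps" "length ps = cpar (Suc i)"
      "visits (Suc i) (run i) ps (after (C(Suc i := a)) u) v"
      by (rule alg_phase_SucE[OF Suc.prems(2) i(1)])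
    \<comment> \<open>The subphase \<open>u'\<close> is the visit to \<open>p\<close> if
      \<open>p\<close> is among \<open>ps\<close>, and the learning subphase otherwise.\<close>
    have "\<exists>xs u' zs C'. ?rs = xs @ requests u' @ zs \<and> run i C' u' \<and> admissible M n C' u' \<and>
        c * real (req_count n u' p) \<le> 5/4 * N"
    proof (cases "p \<in> set ps")
      case True
      obtain t1 u' t2 where u': "v = t1 @ Move (Suc i) p # u' @ t2"
        "run i ((after (after (C(Suc i := a)) u) t1)(Suc i := p)) u'"
        by (rule visits_member[OF *(6) True])
      let ?C = "(after (after (C(Suc i := a)) u) t1)(Suc i := p)"
      have adm: "admissible M n ?C u'"
        using t(2) *(1) u'(1) by (simp add: admissible_append after_append del: fun_upd_apply)
      have "r n \<noteq> p" if "r \<in> set (requests u')" for r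
        using request_avoids_parked_server[OF adm run_moves_within[OF u'(2)] _ that] by (simp add: n_def)
      then have "filter (\<lambda>r. r n = p) (requests u') = []" by (simp add: filter_empty_conv)
      then have "req_count n u' p = 0" unfolding req_count_def by simp
      moreover have "?rs = (requests u @ requests t1) @ requests u' @ requests t2"
        using *(1) u'(1) by (simp add: requests_append)
      ultimately show ?thesis using adm u'(2) N
        by (intro exI[of _ "requests u @ requests t1"] exI[of _ u'] exI[of _ "requests t2"] exI[of _ ?C]) simp
    next
      case False
      have adm: "admissible M n (C(Suc i := a)) u"
        using t(2) *(1) by (simp add: admissible_append)
      have "c * real (req_count n u p) \<le> 5/4 * N"
      \<comment> \<open>\<open>A\<close> is arbitrary here, so \<open>p\<close> may lie outside
        \<open>M n\<close>; then no request has it as a coordinate.\<close>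
      proof (cases "p \<in> M n")
        case True
        have "(cpar n + 1) * req_count n u p \<le> length (requests u)"
          using top_points_count_bound[OF *(3)] True False by (simp add: n_def)
        then have "(c + 1) * real (req_count n u p) \<le> real (length (requests u))"
          unfolding c_def by (metis of_nat_1 of_nat_add of_nat_le_iff of_nat_mult)
        moreover have "real (length (requests u)) \<le> 5/4 * N"
          using run_length_le[OF *(2) admissible_antimono[OF adm] i(1,2)] by (simp add: N_def n_def)
        ultimately show ?thesis by (simp add: algebra_simps)
      next
        case False
        then have "r n \<noteq> p" if "r \<in> set (requests u)" for r
          using request_in_space[OF adm that, of n] i(4) by auto
        then have "filter (\<lambda>r. r n = p) (requests u) = []" by (simp add: filter_empty_conv)
        then have "req_count n u p = 0" unfolding req_count_def by simp
        then show ?thesis using N by simp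
      qed
      moreover have "?rs = [] @ requests u @ requests v" using *(1) by (simp add: requests_append)
      ultimately show ?thesis using adm *(2) by blast
    qed
    then obtain xs u' zs C' where u': "?rs = xs @ requests u' @ zs" "run i C' u'"
      "admissible M n C' u'" "c * real (req_count n u' p) \<le> 5/4 * N"
      by blast
    define B where "B = (\<lambda>s. A (s + length xs))"
    have "unserved i B (requests u') \<le>
        unserved n B (requests u') + length (filter (\<lambda>r. r n = p) (requests u'))"
      unfolding n_def
      by (rule unserved_parked_server) (use parked u'(1) in \<open>simp add: B_def n_def\<close>)
    also have "\<dots> \<le> unserved n A ?rs + req_count n u' p"
      using unserved_infix[of n A xs "requests u'" zs] u'(1) by (simp add: B_def req_count_def)
    finally have "c * real (unserved i B (requests u')) \<le>
        c * real (unserved n A ?rs + req_count n u' p)"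
      using c by (intro mult_left_mono) (use of_nat_le_iff in \<open>blast, simp\<close>)
    \<comment> \<open>11/16 + 5/4 = 31/16, just below the allowance of
      \<open>run_competitive\<close>.\<close>
    also have "\<dots> \<le> 2 * N" using ignored u'(4) N by (simp add: algebra_simps)
    finally have w_le: "w n \<le> 2 * real (Rpar i) * adv_cost w i (length (requests u')) B"
      using run_competitive[OF Suc.IH i(1,2) u'(2) admissible_antimono[OF u'(3)]] i
      by (simp add: N_def n_def c_def)
    have "adv_cost w i (length (requests u')) B \<le> adv_cost w n (length (requests u')) B"
      using wnn by (intro adv_cost_mono) (auto simp: n_def)
    also have "\<dots> \<le> adv_cost w n (length ?rs) A"
      unfolding u'(1) B_def using wnn by (rule adv_cost_infix)
    finally have "2 * real (Rpar i) * adv_cost w i (length (requests u')) B \<le>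
        2 * real (Rpar i) * adv_cost w n (length ?rs) A"
      by (intro mult_left_mono) auto
    with w_le have "w n \<le> 2 * real (Rpar i) * adv_cost w n (length ?rs) A" by linarith
    then have "phase_cost n \<le> 2 * (1 + c) * (2 * real (Rpar i) * adv_cost w n (length ?rs) A)"
      unfolding cost using c by (intro mult_left_mono) auto
    also have "\<dots> = (4 * (1 + c)) * (8 * c * adv_cost w n (length ?rs) A)" by (simp add: R)
    \<comment> \<open>One level costs a factor 4 (1 + c), which is at most 8 c =
      \<open>Rpar i\<close>; this matches \<open>Rpar n\<close> being the square of
      \<open>Rpar i\<close>.\<close>
    also have "\<dots> \<le> (8 * c) * (8 * c * adv_cost w n (length ?rs) A)"
      using c by (intro mult_right_mono mult_nonneg_nonneg adv_cost_nonneg wnn) auto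
    finally show ?thesis by (simp add: R mult.assoc)
  qed
  then show ?case by (simp add: n_def)
qed

end

theorem theorem5:
  fixes M :: "nat \<Rightarrow> 'p set" and w :: "nat \<Rightarrow> real" and k i :: nat
    and C :: "'p config" and tr :: "'p trace"
    and I :: "nat set" and A :: "nat \<Rightarrow> 'p config"
  assumes weights_pos: "\<forall>j\<in>{1..k}. w j > 0"
    and w1: "w 1 = 1"
    and weights_mult: "\<forall>j\<in>{2..k}. \<exists>m::int. w j = of_int m * (2 * (1 + real (cpar (j - 1))) * w (j - 1))"
    and spaces_large: "\<forall>j\<in>{1..k}. infinite (M j) \<or> cpar j \<le> card (M j)"
    and i_range: "1 \<le> i" "i \<le> k"
    and start: "config_in M i C"
    and phase: "alg_phase M w i C tr"
    and unsatisfied: "admissible M i C tr"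
    and ignored: "I \<subseteq> {..<length (requests tr)}"
      "real (card I) \<le> 4 / real (cpar (i + 1)) * real (length (requests tr))"
    and adv: "adversary M i (requests tr) I A"
  shows "trace_cost w C tr \<le> real (Rpar i) * adv_cost w i (length (requests tr)) A"
proof -
  interpret weighted_uniform_spaces M w k
    using weights_pos w1 weights_mult by unfold_locales auto
  have "{t. t < length (requests tr) \<and> \<not> serves i (A (Suc t)) (requests tr ! t)} \<subseteq> I"
    using adv by (auto simp: adversary_def)
  then have "unserved i A (requests tr) \<le> card I"
    unfolding unserved_def using ignored(1) finite_subset by (intro card_mono) auto
  then have "real (unserved i A (requests tr)) \<le>
      4 / real (cpar (Suc i)) * real (length (requests tr))"
    using ignored(2) by simp
  then have "phase_cost i \<le> real (Rpar i) * adv_cost w i (length (requests tr)) A"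
    using alg_phase_competitive i_range phase unsatisfied by blast
  moreover have "trace_cost w C tr \<le> phase_cost i"
    using alg_phase_cost_le phase i_range by blast
  ultimately show ?thesis by linarith
qed

end
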